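(* Let $\mu$ be a non-atomic Borel probability measure on a standard Borel space $X$. Let $\kappa=(u_1,\dots,u_t)$ and $\kappa'=(v_1,\dots,v_{t'})$ be tuples in $\mathbb{Z}\setminus\{0\}$ and \[ R=\{r\in S_t \ :\ (v_1,\dots,v_{t'})=r(u_1,\dots,u_t)\}. \] Then for comeagerly many $f\in L^0(\mu,\mathbb{T})$, $f^\kappa$ and $f^{\kappa'}$ are almost $R$-disjoint.
   Context: $\mathbb{T}$ is the unit circle. $L^0(\mu,\mathbb{T})$ is the Polish group of $\mu$-equivalence classes of Borel functions $X\to\mathbb{T}$ with pointwise multiplication and the topology of convergence in measure. "For comeagerly many $f$" means for all $f$ in a set containing a countable intersection of dense open sets. $S_t$ is the permutation group of $\{1,\dots,t\}$; for $r\in S_t$ and a $t$-tuple $(x_1,\dots,x_t)$ (of integers or of points of $X$), $r(x_1,\dots,x_t)=(x_{r(1)},\dots,x_{r(t)})$. If $t\neq t'$ then $R=\emptyset$. For $f\in L^0(\mu,\mathbb{T})$ and a tuple $\kappa=(k_1,\dots,k_m)$ of integers, $f^\kappa:X^m\to\mathbb{T}$ is $f^\kappa(x_1,\dots,x_m)=\prod_{i=1}^m f(x_i)^{k_i}$. For tuples $\kappa=(u_1,\dots,u_t)$, $\kappa'=(v_1,\dots,v_{t'})$ in $\mathbb{Z}\setminus\{0\}$ and $R\subseteq S_t$, $f^\kappa$ and $f^{\kappa'}$ are called almost $R$-disjoint if there exists $A\subseteq X$ with $\mu(A)=0$ such that for all $x_1,\dots,x_t,y_1,\dots,y_{t'}\in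 X\setminus A$ with $x_1,\dots,x_t$ pairwise distinct and $y_1,\dots,y_{t'}$ pairwise distinct: if $f^\kappa(x_1,\dots,x_t)=f^{\kappa'}(y_1,\dots,y_{t'})$, then $(y_1,\dots,y_{t'})=r(x_1,\dots,x_t)$ for some $r\in R$. (If $R=\emptyset$ this says that the two values are never equal for such points. The notion does not depend on the representative of $f$.) *)

theory Defs
  imports "HOL-Probability.Probability"
begin

definition standard_borel :: "'a measure \<Rightarrow> bool" where
  "standard_borel M \<longleftrightarrow>
     (\<exists>T. completely_metrizable_space T \<and> separable_space T \<and> topspace T = space M \<and>
          sets M = sigma_sets (topspace T) {U. openin T U})"

definition nonatomic :: "'a measure \<Rightarrow> bool" where
  "nonatomic M \<longleftrightarrow>
     (\<forall>A\<in>sets M. 0 < emeasure M A \<longrightarrow>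
        (\<exists>B\<in>sets M. B \<subseteq> A \<and> 0 < emeasure M B \<and> emeasure M B < emeasure M A))"

definition comeager_in :: "'b topology \<Rightarrow> 'b set \<Rightarrow> bool" where
  "comeager_in T S \<longleftrightarrow> S \<subseteq> topspace T \<and>
     (\<exists>\<U>. countable \<U> \<and> (\<forall>U\<in>\<U>. openin T U \<and> T closure_of U = topspace T) \<and>
          topspace T \<inter> \<Inter>\<U> \<subseteq> S)"

abbreviation circle :: "complex measure" where
  "circle \<equiv> restrict_space borel (sphere 0 1)"

text \<open>Members of \<^term>\<open>M \<rightarrow>\<^sub>M circle\<close> are unconstrained outside \<^term>\<open>space M\<close>; as \<^const>\<open>almost_everywhere\<close>
  ignores points outside \<^term>\<open>space M\<close>, this freedom disappears in the equivalence classes.\<close>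

definition ae_eq_rel :: "'a measure \<Rightarrow> (('a \<Rightarrow> complex) \<times> ('a \<Rightarrow> complex)) set" where
  "ae_eq_rel M = {(f, g). f \<in> M \<rightarrow>\<^sub>M circle \<and> g \<in> M \<rightarrow>\<^sub>M circle \<and> (AE x in M. f x = g x)}"

definition L0 :: "'a measure \<Rightarrow> ('a \<Rightarrow> complex) set set" where
  "L0 M = (M \<rightarrow>\<^sub>M circle) // ae_eq_rel M"

text \<open>The basic neighbourhoods of the class of \<open>f\<close> in the topology of convergence in measure consist
  of the classes of those \<open>g\<close> with \<open>\<mu> {x. dist (f x) (g x) \<ge> e} < e\<close>; see
  \<open>limitin_L0_topology_iff\<close> below.\<close>

definition L0_open :: "'a measure \<Rightarrow> ('a \<Rightarrow> complex) set set \<Rightarrow> bool" where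
  "L0_open M U \<longleftrightarrow> U \<subseteq> L0 M \<and>
     (\<forall>F\<in>U. \<exists>e>0. \<forall>G\<in>L0 M. \<forall>f\<in>F. \<forall>g\<in>G.
        emeasure M {x \<in> space M. e \<le> dist (f x) (g x)} < ennreal e \<longrightarrow> G \<in> U)"

definition L0_topology :: "'a measure \<Rightarrow> ('a \<Rightarrow> complex) set topology" where
  "L0_topology M = topology (L0_open M)"

text \<open>Tuples are lists, so the index set of a \<open>t\<close>-tuple is \<^term>\<open>{..<t}\<close>, and the action of a
  permutation \<open>r\<close> on a tuple is \<^term>\<open>permute_list r\<close>. As \<^const>\<open>permute_list\<close> preserves lengths, tuples of
  different lengths are never related by a permutation.\<close>

definition tuple_power :: "('a \<Rightarrow> complex) \<Rightarrow> int list \<Rightarrow> 'a list \<Rightarrow> complex" where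
  "tuple_power f \<kappa> xs = (\<Prod>i<length \<kappa>. f (xs ! i) powi (\<kappa> ! i))"

definition almost_disjoint ::
    "'a measure \<Rightarrow> (nat \<Rightarrow> nat) set \<Rightarrow> ('a \<Rightarrow> complex) \<Rightarrow> int list \<Rightarrow> int list \<Rightarrow> bool" where
  "almost_disjoint M R f \<kappa> \<kappa>' \<longleftrightarrow>
     (\<exists>A\<in>null_sets M. \<forall>xs ys.
        length xs = length \<kappa> \<and> distinct xs \<and> set xs \<subseteq> space M - A \<and>
        length ys = length \<kappa>' \<and> distinct ys \<and> set ys \<subseteq> space M - A \<and>
        tuple_power f \<kappa> xs = tuple_power f \<kappa>' ys \<longrightarrow>
        (\<exists>r\<in>R. ys = permute_list r xs))"

lemma dist_ge_sets:
  assumes "f \<in> M \<rightarrow>\<^sub>M circle" "g \<in> M \<rightarrow>\<^sub>M circle"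
  shows "{x \<in> space M. e \<le> dist (f x) (g x)} \<in> sets M"
proof -
  have [measurable]: "f \<in> borel_measurable M" "g \<in> borel_measurable M"
    using assms by (auto simp: measurable_restrict_space2_iff)
  show ?thesis by measurable
qed

lemma equiv_ae_eq_rel: "equiv (M \<rightarrow>\<^sub>M circle) (ae_eq_rel M)"
proof (rule equivI)
  show "ae_eq_rel M \<subseteq> (M \<rightarrow>\<^sub>M circle) \<times> (M \<rightarrow>\<^sub>M circle)"
    by (auto simp: ae_eq_rel_def)
  show "refl_on (M \<rightarrow>\<^sub>M circle) (ae_eq_rel M)"
    by (auto simp: refl_on_def ae_eq_rel_def)
  show "sym (ae_eq_rel M)"
    by (auto simp: sym_def ae_eq_rel_def eq_commute)
  show "trans (ae_eq_rel M)"
    unfolding trans_def ae_eq_rel_def by (auto elim: eventually_elim2)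
qed

lemma istopology_L0_open: "istopology (L0_open M)"
  unfolding istopology_def
proof (intro conjI allI impI)
  fix S T assume S: "L0_open M S" and T: "L0_open M T"
  show "L0_open M (S \<inter> T)"
    unfolding L0_open_def
  proof (intro conjI ballI)
    show "S \<inter> T \<subseteq> L0 M" using S by (auto simp: L0_open_def)
    fix F assume F: "F \<in> S \<inter> T"
    then have FL: "F \<in> L0 M" using S by (auto simp: L0_open_def)
    obtain d where d: "d > 0" "\<And>G f g. \<lbrakk>G \<in> L0 M; f \<in> F; g \<in> G;
        emeasure M {x \<in> space M. d \<le> dist (f x) (g x)} < ennreal d\<rbrakk> \<Longrightarrow> G \<in> S"
      using S F unfolding L0_open_def by (meson IntD1)
    obtain e where e: "e > 0" "\<And>G f g. \<lbrakk>G \<in> L0 M; f \<in> F; g \<in> G;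
        emeasure M {x \<in> space M. e \<le> dist (f x) (g x)} < ennreal e\<rbrakk> \<Longrightarrow> G \<in> T"
      using T F unfolding L0_open_def by (meson IntD2)
    have mono: "emeasure M {x \<in> space M. c \<le> dist (f x) (g x)} < ennreal c"
      if "G \<in> L0 M" "f \<in> F" "g \<in> G" "min d e \<le> c"
        "emeasure M {x \<in> space M. min d e \<le> dist (f x) (g x)} < ennreal (min d e)" for G f g c
    proof -
      have m: "f \<in> M \<rightarrow>\<^sub>M circle" "g \<in> M \<rightarrow>\<^sub>M circle"
        using that FL equiv_ae_eq_rel[of M] unfolding L0_def by (meson in_quotient_imp_subset subsetD)+
      have "emeasure M {x \<in> space M. c \<le> dist (f x) (g x)}
          \<le> emeasure M {x \<in> space M. min d e \<le> dist (f x) (g x)}"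
        using that(4) dist_ge_sets[OF m] by (intro emeasure_mono) auto
      also note that(5)
      also have "ennreal (min d e) \<le> ennreal c" using that(4) by (rule ennreal_leI)
      finally show ?thesis .
    qed
    show "\<exists>c>0. \<forall>G\<in>L0 M. \<forall>f\<in>F. \<forall>g\<in>G.
        emeasure M {x \<in> space M. c \<le> dist (f x) (g x)} < ennreal c \<longrightarrow> G \<in> S \<inter> T"
      using d e mono by (intro exI[of _ "min d e"]) (auto 4 3)
  qed
next
  fix \<K> assume K: "\<forall>K\<in>\<K>. L0_open M K"
  show "L0_open M (\<Union>\<K>)"
    unfolding L0_open_def
  proof (intro conjI ballI)
    show "\<Union>\<K> \<subseteq> L0 M" using K by (auto simp: L0_open_def)
    fix F assume "F \<in> \<Union>\<K>"
    then obtain S where "S \<in> \<K>" "F \<in> S" "L0_open M S" using K by auto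
    then show "\<exists>c>0. \<forall>G\<in>L0 M. \<forall>f\<in>F. \<forall>g\<in>G.
        emeasure M {x \<in> space M. c \<le> dist (f x) (g x)} < ennreal c \<longrightarrow> G \<in> \<Union>\<K>"
      unfolding L0_open_def by (meson UnionI)
  qed
qed

lemma openin_L0_topology: "openin (L0_topology M) = L0_open M"
  unfolding L0_topology_def by (rule topology_inverse'[OF istopology_L0_open])

lemma topspace_L0_topology [simp]: "topspace (L0_topology M) = L0 M"
proof -
  have "L0_open M (L0 M)" by (auto simp: L0_open_def intro!: exI[of _ 1])
  then show ?thesis
    unfolding topspace_def openin_L0_topology unfolding L0_open_def by blast
qed

lemma L0_open_ball:
  assumes "finite_measure M" and f: "f \<in> M \<rightarrow>\<^sub>M circle" and "e > 0"
  shows "L0_open M {G \<in> L0 M. \<forall>g\<in>G. measure M {x \<in> space M. e \<le> dist (f x) (g x)} < e}"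
    (is "L0_open M ?B")
  unfolding L0_open_def
proof (intro conjI ballI)
  interpret finite_measure M by fact
  show "?B \<subseteq> L0 M" by auto
  fix G assume G: "G \<in> ?B"
  then have "G \<in> (M \<rightarrow>\<^sub>M circle) // ae_eq_rel M" by (simp add: L0_def)
  then obtain g where g: "g \<in> M \<rightarrow>\<^sub>M circle" "G = ae_eq_rel M `` {g}"
    by (rule quotientE)
  have "g \<in> G" unfolding g(2) using g(1) by (rule equiv_class_self[OF equiv_ae_eq_rel])
  have less: "measure M {x \<in> space M. e \<le> dist (f x) (g x)} < e"
    using G \<open>g \<in> G\<close> by auto
  let ?D = "\<lambda>n. {x \<in> space M. e - 1 / Suc n \<le> dist (f x) (g x)}"
  have "(\<lambda>n. measure M (?D n)) \<longlonglongrightarrow> measure M (\<Inter>n. ?D n)"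
  proof (rule finite_Lim_measure_decseq)
    show "range ?D \<subseteq> sets M" using dist_ge_sets[OF f g(1)] by auto
    have "1 / real (Suc n) \<le> 1 / real (Suc m)" if "m \<le> n" for m n
      using that by (simp add: frac_le)
    then have "e - 1 / real (Suc m) \<le> e - 1 / real (Suc n)" if "m \<le> n" for m n
      using that by simp
    then show "decseq ?D"
      unfolding decseq_def by (intro allI impI subsetI CollectI) (metis (lifting) mem_Collect_eq order_trans)
  qed
  also have "(\<Inter>n. ?D n) = {x \<in> space M. e \<le> dist (f x) (g x)}"
  proof (intro equalityI subsetI)
    fix x assume x: "x \<in> (\<Inter>n. ?D n)"
    have "(\<lambda>n. e - 1 / real (Suc n)) \<longlonglongrightarrow> e - 0"
      by (intro tendsto_diff tendsto_const LIMSEQ_Suc[OF lim_1_over_n])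
    moreover have "e - 1 / real (Suc n) \<le> dist (f x) (g x)" for n using x by auto
    ultimately show "x \<in> {x \<in> space M. e \<le> dist (f x) (g x)}"
      using x LIMSEQ_le_const2[of "\<lambda>n. e - 1 / real (Suc n)" "e - 0" "dist (f x) (g x)"] by auto
  next
    fix x assume x: "x \<in> {x \<in> space M. e \<le> dist (f x) (g x)}"
    have "e - 1 / real (Suc n) \<le> dist (f x) (g x)" for n
    proof -
      have "e - 1 / real (Suc n) \<le> e" by simp
      also have "\<dots> \<le> dist (f x) (g x)" using x by simp
      finally show ?thesis .
    qed
    then show "x \<in> (\<Inter>n. ?D n)" using x by blast
  qed
  finally have "eventually (\<lambda>n. measure M (?D n) < e) sequentially"
    using less by (rule order_tendstoD)
  then obtain n where n: "measure M (?D n) < e" by (auto simp: eventually_sequentially)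
  define c where "c = min (1 / Suc n) (e - measure M (?D n))"
  have "c > 0" using n by (simp add: c_def)
  have "H \<in> ?B" if H: "H \<in> L0 M" "g' \<in> G" "h \<in> H"
      "emeasure M {x \<in> space M. c \<le> dist (g' x) (h x)} < ennreal c" for H g' h
  proof -
    have "measure M {x \<in> space M. e \<le> dist (f x) (h' x)} < e" if "h' \<in> H" for h'
    proof -
      have gg: "AE x in M. g x = g' x" "g' \<in> M \<rightarrow>\<^sub>M circle"
        using H(2) g by (auto simp: ae_eq_rel_def)
      have hh: "AE x in M. h x = h' x" "h \<in> M \<rightarrow>\<^sub>M circle" "h' \<in> M \<rightarrow>\<^sub>M circle"
        using in_quotient_imp_in_rel[OF equiv_ae_eq_rel, of H M h h'] H(1,3) that
        unfolding L0_def by (auto simp: ae_eq_rel_def)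
      have c: "measure M {x \<in> space M. c \<le> dist (g' x) (h x)} < c"
        using H(4) \<open>c > 0\<close> by (simp add: emeasure_eq_measure ennreal_less_iff)
      have "measure M {x \<in> space M. e \<le> dist (f x) (h' x)}
          \<le> measure M (?D n \<union> {x \<in> space M. c \<le> dist (g' x) (h x)})"
      proof (rule finite_measure_mono_AE)
        show "?D n \<union> {x \<in> space M. c \<le> dist (g' x) (h x)} \<in> sets M"
          using f g(1) gg(2) hh(2) by (intro sets.Un dist_ge_sets)
        show "AE x in M. x \<in> {x \<in> space M. e \<le> dist (f x) (h' x)} \<longrightarrow>
            x \<in> ?D n \<union> {x \<in> space M. c \<le> dist (g' x) (h x)}"
          using gg(1) hh(1)
        proof eventually_elim
          case (elim x)
          have "c \<le> 1 / Suc n" by (simp add: c_def)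
          then show ?case using dist_triangle[of "f x" "h x" "g x"] elim by auto
        qed
      qed
      also have "\<dots> \<le> measure M (?D n) + measure M {x \<in> space M. c \<le> dist (g' x) (h x)}"
        using f g(1) gg(2) hh(2) by (intro measure_Un_le dist_ge_sets)
      also have "\<dots> < measure M (?D n) + c" using c by simp
      also have "\<dots> \<le> e" by (simp add: c_def)
      finally show ?thesis .
    qed
    then show ?thesis using H(1) by auto
  qed
  then show "\<exists>c>0. \<forall>H\<in>L0 M. \<forall>g\<in>G. \<forall>h\<in>H.
      emeasure M {x \<in> space M. c \<le> dist (g x) (h x)} < ennreal c \<longrightarrow> H \<in> ?B"
    using \<open>c > 0\<close> by blast
qed

lemma limitin_L0_topology_iff:
  assumes "finite_measure M" and f: "f \<in> M \<rightarrow>\<^sub>M circle" and fn: "\<And>n. fn n \<in> M \<rightarrow>\<^sub>M circle"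
  shows "limitin (L0_topology M) (\<lambda>n. ae_eq_rel M `` {fn n}) (ae_eq_rel M `` {f}) sequentially \<longleftrightarrow>
    (\<forall>e>0. (\<lambda>n. measure M {x \<in> space M. e \<le> dist (f x) (fn n x)}) \<longlonglongrightarrow> 0)"
    (is "?L \<longleftrightarrow> ?R")
proof -
  interpret finite_measure M by fact
  have self: "h \<in> ae_eq_rel M `` {h}" if "h \<in> M \<rightarrow>\<^sub>M circle" for h
    using that by (rule equiv_class_self[OF equiv_ae_eq_rel])
  have L0: "ae_eq_rel M `` {h} \<in> L0 M" if "h \<in> M \<rightarrow>\<^sub>M circle" for h
    unfolding L0_def using that by (rule quotientI)
  show ?thesis
  proof
    assume L: ?L
    have "eventually (\<lambda>n. measure M {x \<in> space M. e \<le> dist (f x) (fn n x)} < r) sequentially"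
      if "e > 0" "r > 0" for e r :: real
    proof -
      define c where "c = min e r"
      let ?B = "{G \<in> L0 M. \<forall>g\<in>G. measure M {x \<in> space M. c \<le> dist (f x) (g x)} < c}"
      have "c > 0" using that by (simp add: c_def)
      have "measure M {x \<in> space M. c \<le> dist (f x) (g x)} < c" if "g \<in> ae_eq_rel M `` {f}" for g
      proof -
        have g: "AE x in M. f x = g x" "g \<in> M \<rightarrow>\<^sub>M circle"
          using that by (auto simp: ae_eq_rel_def)
        have "measure M {x \<in> space M. c \<le> dist (f x) (g x)} \<le> measure M {}"
          using g(1) \<open>c > 0\<close> by (intro finite_measure_mono_AE) (auto elim!: eventually_mono)
        then show ?thesis using \<open>c > 0\<close> by simp
      qed
      then have "ae_eq_rel M `` {f} \<in> ?B" using L0[OF f] by auto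
      moreover have "openin (L0_topology M) ?B"
        unfolding openin_L0_topology by (rule L0_open_ball) fact+
      ultimately have "eventually (\<lambda>n. ae_eq_rel M `` {fn n} \<in> ?B) sequentially"
        using L unfolding limitin_def by blast
      then show ?thesis
      proof eventually_elim
        case (elim n)
        have "measure M {x \<in> space M. e \<le> dist (f x) (fn n x)}
            \<le> measure M {x \<in> space M. c \<le> dist (f x) (fn n x)}"
          by (rule finite_measure_mono) (use dist_ge_sets[OF f fn] in \<open>auto simp: c_def\<close>)
        also have "\<dots> < c" using elim self[OF fn[of n]] by blast
        also have "\<dots> \<le> r" by (simp add: c_def)
        finally show ?case .
      qed
    qed
    then show ?R by (simp add: tendsto_iff)
  next
    assume R: ?R
    show ?L
      unfolding limitin_def openin_L0_topology
    proof (intro conjI allI impI)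
      show "ae_eq_rel M `` {f} \<in> topspace (L0_topology M)" using L0[OF f] by simp
      fix U assume "L0_open M U \<and> ae_eq_rel M `` {f} \<in> U"
      then obtain e where e: "e > 0" "\<And>G f' g. \<lbrakk>G \<in> L0 M; f' \<in> ae_eq_rel M `` {f}; g \<in> G;
          emeasure M {x \<in> space M. e \<le> dist (f' x) (g x)} < ennreal e\<rbrakk> \<Longrightarrow> G \<in> U"
        unfolding L0_open_def by meson
      have "eventually (\<lambda>n. measure M {x \<in> space M. e \<le> dist (f x) (fn n x)} < e) sequentially"
        using R e(1) order_tendstoD(2) by blast
      then show "eventually (\<lambda>n. ae_eq_rel M `` {fn n} \<in> U) sequentially"
      proof eventually_elim
        case (elim n)
        then show ?case
          using e(1) by (intro e(2)[OF L0[OF fn] self[OF f] self[OF fn]])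
            (simp add: emeasure_eq_measure ennreal_less_iff)
      qed
    qed
  qed
qed

end

theory Submission
  imports Defs
begin

text \<open>
  For comeagerly many \<open>f\<close> there is a null set off which the values of \<open>f\<close> at distinct points satisfy
  no multiplicative relation with integer exponents, other than the trivial one. This is stronger
  than the claim: an equality \<open>f\<^sup>\<kappa>(x) = f\<^sup>\<kappa>'(y)\<close> is a relation among the values of \<open>f\<close> on the points of
  \<open>x\<close> and \<open>y\<close>, so every point has the same exponent on both sides. As the exponents are nonzero, the
  pairs \<open>(y\<^sub>j, v\<^sub>j)\<close> are a rearrangement of the pairs \<open>(x\<^sub>i, u\<^sub>i)\<close>, which is a permutation in \<open>R\<close>
  (\<open>almost_disjoint_if_mult_independent\<close>).

  Independence off a null set is not visibly a countable intersection of open conditions, so it is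
  approximated. Fix measurable sets \<open>E\<^sub>0, E\<^sub>1, \<dots>\<close> that separate points, and let the \<open>n\<close>-th condition on
  \<open>f\<close> say that, off a set of measure less than \<open>2\<^sup>-\<^sup>n\<close>, every nontrivial relation among points that
  \<open>E\<^sub>0, \<dots>, E\<^sub>n\<^sub>-\<^sub>1\<close> tell apart, with exponents at most \<open>n\<close> in absolute value, fails by at least some
  \<open>d > 0\<close> (\<open>near_independent\<close>).

  The condition is open because at most \<open>2\<^sup>n\<close> points occur in such a relation, so a small uniform change
  of \<open>f\<close> changes the product by less than \<open>d\<close>, while a change of \<open>f\<close> on a set of small measure only
  costs a little of the room below \<open>2\<^sup>-\<^sup>n\<close> (\<open>near_independent_perturb\<close>). It is dense because \<open>f\<close> is
  uniformly close to a function with finitely many values, constant on a partition that refines the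
  one generated by \<open>E\<^sub>0, \<dots>, E\<^sub>n\<^sub>-\<^sub>1\<close>, and these values can be moved to independent ones: only finitely
  many bounded relations are left, so they fail by a uniform \<open>d\<close> (\<open>near_independent_dense\<close>).

  If all the conditions hold, then by the Borel-Cantelli lemma almost every point lies in all but
  finitely many of the good sets. Finitely many such points and a given tuple of exponents are therefore
  covered by the \<open>n\<close>-th condition once \<open>n\<close> is large (\<open>mult_independent_if_near_independent\<close>).
\<close>

section \<open>Multiplicative independence\<close>

definition mult_independent_on :: "('b \<Rightarrow> complex) \<Rightarrow> 'b set \<Rightarrow> bool" where
  "mult_independent_on f S \<longleftrightarrow>
     (\<forall>J a. finite J \<and> J \<subseteq> S \<and> (\<Prod>x\<in>J. f x powi a x) = 1 \<longrightarrow> (\<forall>x\<in>J. a x = 0))"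

lemma finite_powi_roots:
  fixes c :: complex
  assumes "m \<noteq> 0"
  shows "finite {z. z powi m = c}"
proof (cases "m \<ge> 0")
  case True
  then have "{z. z powi m = c} = {z. z ^ nat m = c}"
    by (simp add: power_int_def)
  then show ?thesis using assms True finite_nth_roots[of "nat m" c] by simp
next
  case False
  then have "{z. z powi m = c} \<subseteq> {z. z ^ nat (- m) = inverse c}"
    by (auto simp: power_int_def power_inverse)
  moreover have "finite {z. z ^ nat (- m) = inverse c}"
    using False by (intro finite_nth_roots) simp
  ultimately show ?thesis by (rule finite_subset)
qed

lemma exists_circle_point_near_avoiding_countable:
  fixes w :: complex
  assumes "norm w = 1" "e > 0" "countable C"
  shows "\<exists>z. norm z = 1 \<and> dist z w < e \<and> z \<notin> C"
proof -
  let ?I = "{0 <..< min 1 e}"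
  have inj: "inj_on (\<lambda>t. w * cis t) ?I"
  proof (rule inj_onI)
    fix s t assume st: "s \<in> ?I" "t \<in> ?I" "w * cis s = w * cis t"
    then have "cis s = cis t" using assms(1) by auto
    then have "sin s = sin t" by (metis cis.simps(2))
    moreover have "{s, t} \<subseteq> {- (pi / 2) .. pi / 2}"
      using st pi_gt3 by auto
    ultimately show "s = t"
      by (auto dest: sin_inj_pi[rotated 4])
  qed
  have "\<not> countable ?I" using uncountable_open_interval assms(2) by auto
  then have "\<not> countable ((\<lambda>t. w * cis t) ` ?I)"
    using countable_image_inj_on[OF _ inj] by blast
  then have "\<not> (\<lambda>t. w * cis t) ` ?I \<subseteq> C"
    using assms(3) countable_subset by metis
  then obtain t where t: "t \<in> ?I" "w * cis t \<notin> C" by blast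
  have "dist (w * cis t) w = norm (w * (cis t - 1))"
    by (simp add: dist_norm algebra_simps)
  also have "\<dots> = norm (exp (\<i> * of_real t) - 1)"
    using assms(1) by (simp add: norm_mult cis_conv_exp)
  also have "\<dots> = 2 * \<bar>sin (t / 2)\<bar>" by (rule dist_exp_i_1)
  also have "\<dots> \<le> t" using abs_sin_x_le_abs_x[of "t / 2"] t by auto
  also have "t < e" using t by auto
  finally show ?thesis using t assms(1) by (intro exI[of _ "w * cis t"]) (simp add: norm_mult)
qed

text \<open>The values are chosen one at a time. A new value is dependent on the earlier ones only if a
  nonzero power of it lies in the countable group that they generate, and each element of that
  group has finitely many roots of a given order, whereas an arc of the circle is uncountable.\<close>

lemma exists_independent_near:
  fixes w :: "'b \<Rightarrow> complex"
  assumes "finite I" "\<And>i. i \<in> I \<Longrightarrow> norm (w i) = 1" "e > 0"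
  shows "\<exists>c. (\<forall>i\<in>I. norm (c i) = 1 \<and> dist (c i) (w i) < e) \<and> mult_independent_on c I"
  using assms(1,2)
proof (induction I rule: finite_induct)
  case empty
  then show ?case by (simp add: mult_independent_on_def)
next
  case (insert k I)
  then obtain c where c: "\<And>i. i \<in> I \<Longrightarrow> norm (c i) = 1 \<and> dist (c i) (w i) < e"
      "mult_independent_on c I"
    by auto
  \<comment> \<open>\<open>?V\<close> is the group generated by the earlier values and \<open>?C\<close> the set of all roots of its elements.\<close>
  let ?V = "(\<lambda>a. \<Prod>i\<in>I. c i powi a i) ` (I \<rightarrow>\<^sub>E (UNIV :: int set))"
  let ?C = "\<Union>m\<in>{m. m \<noteq> 0}. \<Union>v\<in>?V. {z. z powi m = v}"
  have "countable ?V" using insert.hyps(1) by (intro countable_image countable_PiE) auto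
  then have "countable ?C" by (intro countable_UN) (auto intro: countable_finite finite_powi_roots)
  then obtain z where z: "norm z = 1" "dist z (w k) < e" "z \<notin> ?C"
    using exists_circle_point_near_avoiding_countable[of "w k" e ?C] insert.prems assms(3) by auto
  let ?c = "c(k := z)"
  have "mult_independent_on ?c (insert k I)"
    unfolding mult_independent_on_def
  proof (intro allI impI, elim conjE)
    fix J a assume J: "finite J" "J \<subseteq> insert k I" and rel: "(\<Prod>x\<in>J. ?c x powi a x) = 1"
    have J': "finite (J - {k})" "J - {k} \<subseteq> I" using J by auto
    have rest: "(\<Prod>x\<in>J - {k}. ?c x powi b x) = (\<Prod>x\<in>J - {k}. c x powi b x)" for b
      by (intro prod.cong) auto
    have k0: "a k = 0" if "k \<in> J"
    proof (rule ccontr)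
      assume "a k \<noteq> 0"
      have "z powi a k * (\<Prod>x\<in>J - {k}. c x powi a x) = 1"
        using rel J(1) that by (subst (asm) prod.remove[of _ k]) (auto simp: rest)
      then have "z powi a k = inverse (\<Prod>x\<in>J - {k}. c x powi a x)"
        by (metis inverse_unique mult.commute)
      also have "\<dots> = (\<Prod>x\<in>J - {k}. c x powi (- a x))"
        by (simp add: power_int_minus prod_inversef[symmetric] o_def)
      also have "\<dots> = (\<Prod>x\<in>I. c x powi (if x \<in> J then - a x else 0))"
        using J' insert.hyps by (intro prod.mono_neutral_cong_left) auto
      also have "\<dots> = (\<Prod>x\<in>I. c x powi (restrict (\<lambda>x. if x \<in> J then - a x else 0) I x))"
        by (intro prod.cong) auto
      also have "\<dots> \<in> ?V" by (intro imageI) auto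
      finally have "z \<in> ?C" using \<open>a k \<noteq> 0\<close> by blast
      then show False using z(3) by blast
    qed
    have "(\<Prod>x\<in>J - {k}. c x powi a x) = 1"
    proof (cases "k \<in> J")
      case True
      then show ?thesis
        using rel J(1) k0 by (subst (asm) prod.remove[of _ k]) (auto simp: rest)
    next
      case False
      then show ?thesis using rel rest[of a] by simp
    qed
    then have "\<forall>x\<in>J - {k}. a x = 0"
      using c(2) J' unfolding mult_independent_on_def by blast
    then show "\<forall>x\<in>J. a x = 0" using k0 by auto
  qed
  moreover have "\<forall>i\<in>insert k I. norm (?c i) = 1 \<and> dist (?c i) (w i) < e"
    using c z insert.hyps by auto
  ultimately show ?case by blast
qed

section \<open>Bounded relations among points with distinct labels\<close>

text \<open>Injectivity of the labelling \<open>q\<close> on \<open>J\<close> serves two purposes: it bounds the size of \<open>J\<close> when there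
  are finitely many labels, and it lets a function that factors through \<open>q\<close> satisfy the condition,
  since only relations among its values at different labels are tested.\<close>

definition relation_gap ::
    "('a \<Rightarrow> complex) \<Rightarrow> ('a \<Rightarrow> 'b) \<Rightarrow> nat \<Rightarrow> real \<Rightarrow> 'a set \<Rightarrow> bool" where
  "relation_gap f q N d B \<longleftrightarrow>
     (\<forall>J a. finite J \<and> J \<subseteq> B \<and> inj_on q J \<and> (\<forall>x\<in>J. \<bar>a x\<bar> \<le> int N) \<and> (\<exists>x\<in>J. a x \<noteq> 0)
        \<longrightarrow> d \<le> dist (\<Prod>x\<in>J. f x powi a x) 1)"

text \<open>On a finite set there are finitely many tuples of bounded exponents, so the distances of the
  corresponding products to \<open>1\<close>, all of them positive, have a positive minimum.\<close>

lemma relation_gap_of_independent: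
  fixes c :: "'b \<Rightarrow> complex"
  assumes "finite I" "mult_independent_on c I"
  shows "\<exists>d>0. relation_gap c id N d I"
proof -
  let ?A = "{a \<in> I \<rightarrow>\<^sub>E {- int N .. int N}. \<exists>x\<in>I. a x \<noteq> 0}"
  let ?D = "(\<lambda>a. dist (\<Prod>x\<in>I. c x powi a x) 1) ` ?A"
  have fin: "finite ?D"
  proof (intro finite_imageI)
    show "finite ?A"
      by (rule finite_subset[OF _ finite_PiE[OF assms(1), of "\<lambda>_. {- int N .. int N}"]]) auto
  qed
  have pos: "0 < r" if r_in: "r \<in> ?D" for r
  proof -
    obtain a x where r: "r = dist (\<Prod>x\<in>I. c x powi a x) 1" and "x \<in> I" "a x \<noteq> 0"
      using r_in by blast
    then have "(\<Prod>x\<in>I. c x powi a x) \<noteq> 1"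
      using assms unfolding mult_independent_on_def by blast
    then show ?thesis by (simp add: r)
  qed
  \<comment> \<open>The element \<open>1\<close> provides for \<open>I = {}\<close> and \<open>N = 0\<close>, when \<open>?D\<close> is empty.\<close>
  define d where "d = Min (insert 1 ?D)"
  have "d > 0" using fin pos by (auto simp: d_def)
  moreover have "relation_gap c id N d I"
    unfolding relation_gap_def
  proof (intro allI impI, elim conjE)
    fix J a assume J: "J \<subseteq> I" and a: "\<forall>x\<in>J. \<bar>a x\<bar> \<le> int N" "\<exists>x\<in>J. a x \<noteq> 0"
    let ?a = "restrict (\<lambda>x. if x \<in> J then a x else 0) I"
    have "(\<Prod>x\<in>J. c x powi a x) = (\<Prod>x\<in>I. c x powi ?a x)"
      using J assms(1) by (intro prod.mono_neutral_cong_left) auto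
    moreover have "?a \<in> ?A" using J a by (fastforce simp: abs_le_iff)
    ultimately have "dist (\<Prod>x\<in>J. c x powi a x) 1 \<in> ?D" by (intro image_eqI[of _ _ ?a]) simp_all
    then show "d \<le> dist (\<Prod>x\<in>J. c x powi a x) 1" using fin by (simp add: d_def)
  qed
  ultimately show ?thesis by blast
qed

lemma relation_gap_comp:
  assumes "relation_gap c id N d I" "\<And>x. x \<in> B \<Longrightarrow> q x \<in> I"
  shows "relation_gap (\<lambda>x. c (q x)) q N d B"
  unfolding relation_gap_def
proof (intro allI impI, elim conjE)
  fix J a assume J: "finite J" "J \<subseteq> B" "inj_on q J"
    and a: "\<forall>x\<in>J. \<bar>a x\<bar> \<le> int N" "\<exists>x\<in>J. a x \<noteq> 0"
  let ?a = "\<lambda>i. a (the_inv_into J q i)"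
  have "(\<Prod>i\<in>q ` J. c i powi ?a i) = (\<Prod>x\<in>J. c (q x) powi a x)"
    using J(3) by (subst prod.reindex) (auto simp: the_inv_into_f_f intro!: prod.cong)
  moreover have "d \<le> dist (\<Prod>i\<in>q ` J. c i powi ?a i) 1"
    using J a assms unfolding relation_gap_def
    by (elim allE[of _ "q ` J"] allE[of _ ?a] impE) (auto simp: the_inv_into_f_f)
  ultimately show "d \<le> dist (\<Prod>x\<in>J. c (q x) powi a x) 1" by simp
qed

lemma relation_gap_coarser:
  assumes "relation_gap f q N d B" "\<And>x y. x \<in> B \<Longrightarrow> y \<in> B \<Longrightarrow> q x = q y \<Longrightarrow> p x = p y"
  shows "relation_gap f p N d B"
proof -
  have "inj_on q J" if "J \<subseteq> B" "inj_on p J" for J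
    using that assms(2) by (meson inj_onD inj_onI subsetD)
  then show ?thesis using assms(1) unfolding relation_gap_def by blast
qed

lemma dist_powi_le:
  fixes z w :: complex
  assumes "norm z = 1" "norm w = 1"
  shows "dist (z powi m) (w powi m) \<le> \<bar>of_int m\<bar> * dist z w"
proof -
  have pow: "dist (u ^ n) (v ^ n) \<le> real n * dist u v" if "norm u = 1" "norm v = 1" for u v :: complex and n
    using norm_power_diff[of u v n] that by (simp add: dist_norm)
  have inv: "dist (inverse z) (inverse w) = dist z w"
  proof -
    have "z \<noteq> 0" "w \<noteq> 0" using assms by auto
    then show ?thesis
      using assms by (simp add: dist_norm inverse_diff_inverse norm_mult norm_inverse)
  qed
  show ?thesis
  proof (cases "m \<ge> 0")
    case True
    then show ?thesis using pow[OF assms, of "nat m"] by (simp add: power_int_def)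
  next
    case False
    then show ?thesis using pow[of "inverse z" "inverse w" "nat (- m)"] assms inv
      by (simp add: power_int_def norm_inverse)
  qed
qed

text \<open>For numbers of norm at most \<open>1\<close>, changing the factors changes a product by at most the sum
  of the changes.\<close>

lemma relation_gap_perturb:
  assumes gap: "relation_gap f q N d B"
    and card: "\<And>J. J \<subseteq> B \<Longrightarrow> inj_on q J \<Longrightarrow> card J \<le> K"
    and norm: "\<And>x. x \<in> B \<Longrightarrow> norm (f x) = 1 \<and> norm (g x) = 1"
    and close: "\<And>x. x \<in> B \<Longrightarrow> dist (f x) (g x) \<le> e"
    and "0 \<le> e"
  shows "relation_gap g q N (d - real K * (real N * e)) B"
  unfolding relation_gap_def
proof (intro allI impI, elim conjE)
  fix J a assume J: "finite J" "J \<subseteq> B" "inj_on q J"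
    and a: "\<forall>x\<in>J. \<bar>a x\<bar> \<le> int N" "\<exists>x\<in>J. a x \<noteq> 0"
  let ?F = "\<Prod>x\<in>J. f x powi a x" and ?G = "\<Prod>x\<in>J. g x powi a x"
  have nJ: "norm (f x) = 1 \<and> norm (g x) = 1" if "x \<in> J" for x using that J(2) norm by auto
  have "dist ?F ?G \<le> (\<Sum>x\<in>J. dist (f x powi a x) (g x powi a x))"
    unfolding dist_norm by (rule norm_prod_diff) (auto simp: norm_power_int nJ)
  also have "\<dots> \<le> (\<Sum>x\<in>J. real N * e)"
  proof (rule sum_mono)
    fix x assume x: "x \<in> J"
    have "dist (f x powi a x) (g x powi a x) \<le> \<bar>of_int (a x)\<bar> * dist (f x) (g x)"
      using nJ[OF x] by (intro dist_powi_le) auto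
    also have "\<dots> \<le> real N * e"
      using a x J(2) close[of x] by (intro mult_mono) (auto simp: abs_le_iff)
    finally show "dist (f x powi a x) (g x powi a x) \<le> real N * e" .
  qed
  also have "\<dots> \<le> real K * (real N * e)"
    using card[OF J(2,3)] \<open>0 \<le> e\<close> by (simp add: mult_right_mono)
  finally have "dist ?F ?G \<le> real K * (real N * e)" .
  moreover have "d \<le> dist ?F 1" using gap J a unfolding relation_gap_def by blast
  moreover have "dist ?F 1 \<le> dist ?F ?G + dist ?G 1" by (rule dist_triangle)
  ultimately show "d - real K * (real N * e) \<le> dist ?G 1" by linarith
qed

section \<open>Independence up to a small set\<close>

definition signature :: "(nat \<Rightarrow> 'a set) \<Rightarrow> nat \<Rightarrow> 'a \<Rightarrow> nat set" where
  "signature E n x = {i \<in> {..<n}. x \<in> E i}"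

text \<open>One index \<open>n\<close> bounds the exceptional measure, the exponents and the number of separating sets in
  use. All three constraints are eventually met by given points and exponents, so one sequence of
  conditions takes care of all relations at once; the geometric bound makes the measures summable.\<close>

definition near_independent :: "'a measure \<Rightarrow> (nat \<Rightarrow> 'a set) \<Rightarrow> nat \<Rightarrow> ('a \<Rightarrow> complex) \<Rightarrow> bool" where
  "near_independent M E n f \<longleftrightarrow>
     (\<exists>d>0. \<exists>B\<in>sets M. measure M (space M - B) < (1/2) ^ n \<and> relation_gap f (signature E n) n d B)"

lemma circle_measurable_iff:
  "f \<in> M \<rightarrow>\<^sub>M circle \<longleftrightarrow> f \<in> borel_measurable M \<and> (\<forall>x\<in>space M. norm (f x) = 1)"
  by (auto simp: measurable_restrict_space2_iff)

lemma near_independent_perturb: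
  assumes "finite_measure M" and f: "f \<in> M \<rightarrow>\<^sub>M circle" and near: "near_independent M E n f"
  shows "\<exists>e>0. \<forall>g\<in>M \<rightarrow>\<^sub>M circle.
           measure M {x \<in> space M. e \<le> dist (f x) (g x)} < e \<longrightarrow> near_independent M E n g"
proof -
  interpret finite_measure M by fact
  obtain d B where d: "d > 0" and B: "B \<in> sets M" "measure M (space M - B) < (1/2) ^ n"
    and gap: "relation_gap f (signature E n) n d B"
    using near unfolding near_independent_def by blast
  \<comment> \<open>There are at most \<open>2\<^sup>n\<close> signatures, so a uniform change by \<open>e\<close> costs at most \<open>K * n * e\<close>. The first
    bound in \<open>e\<close> keeps this below \<open>d\<close>, the \<open>+ 1\<close> guarding against \<open>n = 0\<close>; the second leaves room for
    an exceptional set of measure less than \<open>e\<close>.\<close>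
  define K :: nat where "K = 2 ^ n"
  define e where "e = min (d / (2 * (real K * real n + 1))) ((1/2) ^ n - measure M (space M - B))"
  have "e > 0" using d B(2) by (auto simp: e_def add_nonneg_pos)
  have card: "card J \<le> K" if "inj_on (signature E n) J" for J
  proof -
    have "card J = card (signature E n ` J)" using that by (simp add: card_image)
    also have "\<dots> \<le> card (Pow {..<n})" by (intro card_mono) (auto simp: signature_def)
    finally show ?thesis by (simp add: card_Pow K_def)
  qed
  have small: "real K * (real n * e) < d"
  proof -
    have p: "real K * real n + 1 > 0" by (intro add_nonneg_pos) auto
    have "e \<le> d / (2 * (real K * real n + 1))" by (simp add: e_def)
    then have "e * (2 * (real K * real n + 1)) \<le> d" using p by (simp add: field_simps)
    moreover have "0 \<le> real K * (real n * e)" using \<open>e > 0\<close> by simp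
    ultimately show ?thesis using \<open>e > 0\<close> d by (simp add: algebra_simps)
  qed
  have "near_independent M E n g"
    if g: "g \<in> M \<rightarrow>\<^sub>M circle" and less: "measure M {x \<in> space M. e \<le> dist (f x) (g x)} < e" for g
  proof -
    let ?D = "{x \<in> space M. e \<le> dist (f x) (g x)}"
    have D: "?D \<in> sets M" using f g by (rule dist_ge_sets)
    have Bs: "B \<subseteq> space M" using B(1) by (rule sets.sets_into_space)
    have "measure M (space M - (B - ?D)) \<le> measure M ((space M - B) \<union> ?D)"
      using B(1) D by (intro finite_measure_mono) auto
    also have "\<dots> \<le> measure M (space M - B) + measure M ?D"
      using B(1) D by (intro measure_Un_le) auto
    also have "\<dots> < (1/2) ^ n" using less by (simp add: e_def)
    finally have "measure M (space M - (B - ?D)) < (1/2) ^ n" .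
    moreover have "relation_gap g (signature E n) n (d - real K * (real n * e)) (B - ?D)"
    proof (rule relation_gap_perturb)
      show "relation_gap f (signature E n) n d (B - ?D)"
        using gap unfolding relation_gap_def by blast
      show "norm (f x) = 1 \<and> norm (g x) = 1" if "x \<in> B - ?D" for x
        using that Bs f g by (auto simp: circle_measurable_iff)
    qed (use card \<open>e > 0\<close> Bs in auto)
    moreover have "B - ?D \<in> sets M" using B(1) D by auto
    ultimately show ?thesis using small unfolding near_independent_def
      by (intro exI[of _ "d - real K * (real n * e)"]) auto
  qed
  then show ?thesis using \<open>e > 0\<close> by blast
qed

lemma measurable_finite_label:
  assumes "finite K" "\<And>i. i \<in> K \<Longrightarrow> A i \<in> sets M"
  shows "(\<lambda>x. {i \<in> K. x \<in> A i}) \<in> M \<rightarrow>\<^sub>M count_space (Pow K)"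
proof -
  have fin: "finite (Pow K)" using assms(1) by simp
  show ?thesis
    unfolding measurable_count_space_eq2[OF fin]
  proof (intro conjI ballI)
    show "(\<lambda>x. {i \<in> K. x \<in> A i}) \<in> space M \<rightarrow> Pow K" by auto
    fix S assume S: "S \<in> Pow K"
    have "(\<lambda>x. {i \<in> K. x \<in> A i}) -` {S} \<inter> space M
        = {x \<in> space M. \<forall>i\<in>K. x \<in> (if i \<in> S then A i else space M - A i)}"
      using S by (auto split: if_splits)
    also have "\<dots> \<in> sets M"
      using assms by (intro sets.sets_Collect_finite_All) (auto intro!: sets.sets_Collect_const)
    finally show "(\<lambda>x. {i \<in> K. x \<in> A i}) -` {S} \<inter> space M \<in> sets M" .
  qed
qed

lemma near_independent_dense:
  assumes E: "\<And>i. E i \<in> sets M" and f: "f \<in> M \<rightarrow>\<^sub>M circle" and "e > 0"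
  shows "\<exists>g\<in>M \<rightarrow>\<^sub>M circle. (\<forall>x\<in>space M. dist (f x) (g x) < e) \<and> near_independent M E n g"
proof -
  have [measurable]: "f \<in> borel_measurable M" using f by (simp add: circle_measurable_iff)
  obtain W where W: "finite W" "W \<subseteq> sphere 0 1" "sphere (0::complex) 1 \<subseteq> (\<Union>w\<in>W. ball w (e / 2))"
    using compact_sphere
  proof (rule compactE_image)
    show "sphere (0::complex) 1 \<subseteq> (\<Union>w\<in>sphere 0 1. ball w (e / 2))"
      using \<open>e > 0\<close> by auto
  qed auto
  \<comment> \<open>The label of \<open>x\<close> records its signature and the points of a finite net of the circle close to
    \<open>f x\<close>; the new function depends on \<open>x\<close> only through its label, and its values are independent
    points close to a net point named by the label.\<close>
  define lab where "lab x = (signature E n x, {w \<in> W. x \<in> {x \<in> space M. f x \<in> ball w (e / 2)}})" for x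
  define I where "I = Pow {..<n} \<times> Pow W"
  define pt where "pt s = (if snd s \<inter> W = {} then 1 else SOME w. w \<in> snd s \<inter> W)" for s :: "nat set \<times> complex set"
  have pt: "pt s \<in> snd s \<inter> W" if "snd s \<inter> W \<noteq> {}" for s
    using that unfolding pt_def by (metis some_in_eq)
  have "finite I" using W(1) by (simp add: I_def)
  have labI: "lab x \<in> I" for x by (auto simp: lab_def I_def signature_def)
  have "norm (pt s) = 1" for s
    using pt[of s] W(2) by (cases "snd s \<inter> W = {}") (auto simp: pt_def)
  then obtain c where c: "\<And>i. i \<in> I \<Longrightarrow> norm (c i) = 1 \<and> dist (c i) (pt i) < e / 2" "mult_independent_on c I"
    using exists_independent_near[OF \<open>finite I\<close>, of pt "e / 2"] \<open>e > 0\<close> by auto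
  let ?g = "\<lambda>x. c (lab x)"
  have "lab \<in> M \<rightarrow>\<^sub>M count_space (Pow {..<n}) \<Otimes>\<^sub>M count_space (Pow W)"
    unfolding lab_def signature_def
    using E W(1) by (intro measurable_Pair measurable_finite_label) auto
  then have "lab \<in> M \<rightarrow>\<^sub>M count_space I"
    using W(1) by (simp add: pair_measure_countable countable_finite I_def)
  then have "?g \<in> borel_measurable M" by (rule measurable_compose) simp
  then have g: "?g \<in> M \<rightarrow>\<^sub>M circle" using c(1) labI by (auto simp: circle_measurable_iff)
  moreover have "dist (f x) (?g x) < e" if x: "x \<in> space M" for x
  proof -
    have "f x \<in> sphere 0 1" using f x by (auto simp: circle_measurable_iff)
    then obtain w where "w \<in> W" "f x \<in> ball w (e / 2)" using W(3) by blast
    then have "w \<in> snd (lab x) \<inter> W" using x by (simp add: lab_def)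
    then have "snd (lab x) \<inter> W \<noteq> {}" by blast
    then have "pt (lab x) \<in> snd (lab x)" using pt by blast
    moreover have "snd (lab x) \<subseteq> {w. f x \<in> ball w (e / 2)}" by (auto simp: lab_def)
    ultimately have "f x \<in> ball (pt (lab x)) (e / 2)" by blast
    then have "dist (f x) (pt (lab x)) < e / 2" by (simp add: dist_commute)
    moreover have "dist (?g x) (pt (lab x)) < e / 2" using c(1) labI by blast
    ultimately show ?thesis using dist_triangle_half_l by blast
  qed
  moreover have "near_independent M E n ?g"
  proof -
    obtain d where d: "d > 0" "relation_gap c id n d I"
      using relation_gap_of_independent[OF \<open>finite I\<close> c(2)] by blast
    have "relation_gap ?g lab n d (space M)"
      using d(2) labI by (rule relation_gap_comp)
    then have "relation_gap ?g (signature E n) n d (space M)"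
      by (rule relation_gap_coarser) (simp add: lab_def)
    then show ?thesis using d(1) unfolding near_independent_def
      by (intro exI[of _ d] conjI bexI[of _ "space M"]) auto
  qed
  ultimately show ?thesis by (intro bexI[of _ ?g] conjI ballI)
qed

lemma mult_independent_if_near_independent:
  assumes "finite_measure M"
    and sep: "\<And>x y. x \<in> space M \<Longrightarrow> y \<in> space M \<Longrightarrow> x \<noteq> y \<Longrightarrow> \<exists>i. x \<in> E i \<longleftrightarrow> y \<notin> E i"
    and near: "\<And>n. near_independent M E n f"
  shows "\<exists>A\<in>null_sets M. mult_independent_on f (space M - A)"
proof -
  interpret finite_measure M by fact
  obtain d B where d: "\<And>n. d n > 0" and B: "\<And>n. B n \<in> sets M" "\<And>n. measure M (space M - B n) < (1/2) ^ n"
    and gap: "\<And>n. relation_gap f (signature E n) n (d n) (B n)"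
    using near unfolding near_independent_def by metis
  have "summable (\<lambda>n. measure M (space M - B n))"
  proof (rule summable_comparison_test')
    show "summable (\<lambda>n. (1/2::real) ^ n)" by (rule summable_geometric) simp
    show "norm (measure M (space M - B n)) \<le> (1/2) ^ n" for n using less_imp_le[OF B(2)] by simp
  qed
  then have "AE x in M. eventually (\<lambda>n. x \<in> space M - (space M - B n)) sequentially"
    using B(1) by (intro borel_cantelli_AE1) (auto simp: emeasure_eq_measure)
  then obtain A where A: "A \<in> null_sets M"
      "{x \<in> space M. \<not> eventually (\<lambda>n. x \<in> space M - (space M - B n)) sequentially} \<subseteq> A"
    unfolding eventually_ae_filter by auto
  have evB: "eventually (\<lambda>n. x \<in> B n) sequentially" if "x \<in> space M - A" for x
  proof -
    have "eventually (\<lambda>n. x \<in> space M - (space M - B n)) sequentially" using A(2) that by blast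
    then show ?thesis by eventually_elim auto
  qed
  have "mult_independent_on f (space M - A)"
    unfolding mult_independent_on_def
  proof (intro allI impI, elim conjE, rule ccontr)
    fix J and a :: "'a \<Rightarrow> int"
    assume J: "finite J" "J \<subseteq> space M - A" and rel: "(\<Prod>x\<in>J. f x powi a x) = 1"
      and nz: "\<not> (\<forall>x\<in>J. a x = 0)"
    have "eventually (\<lambda>n. \<forall>x\<in>J. x \<in> B n) sequentially"
      using J evB by (intro eventually_ball_finite) auto
    moreover have "eventually (\<lambda>n. \<forall>x\<in>J. \<bar>a x\<bar> \<le> int n) sequentially"
    proof (intro eventually_ball_finite ballI)
      fix x assume "x \<in> J"
      show "eventually (\<lambda>n. \<bar>a x\<bar> \<le> int n) sequentially"
        using eventually_ge_at_top[of "nat \<bar>a x\<bar>"] by eventually_elim simp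
    qed (use J in auto)
    moreover have "eventually (\<lambda>n. \<forall>x\<in>J. \<forall>y\<in>J. x \<noteq> y \<longrightarrow> signature E n x \<noteq> signature E n y) sequentially"
    proof (intro eventually_ball_finite ballI)
      fix x y assume "x \<in> J" "y \<in> J"
      show "eventually (\<lambda>n. x \<noteq> y \<longrightarrow> signature E n x \<noteq> signature E n y) sequentially"
      proof (cases "x = y")
        case False
        then obtain i where i: "x \<in> E i \<longleftrightarrow> y \<notin> E i" using sep \<open>x \<in> J\<close> \<open>y \<in> J\<close> J(2) by blast
        show ?thesis using eventually_gt_at_top[of i]
          by eventually_elim (use i in \<open>auto simp: signature_def set_eq_iff\<close>)
      qed simp
    qed (use J in auto)
    ultimately have "eventually (\<lambda>n. False) sequentially"
    proof eventually_elim
      case (elim n)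
      have "inj_on (signature E n) J" using elim(3) by (meson inj_onI)
      then have "d n \<le> dist (\<Prod>x\<in>J. f x powi a x) 1"
        using gap[of n] J(1) elim(1,2) nz unfolding relation_gap_def by blast
      then show False using rel d[of n] by simp
    qed
    then show False by simp
  qed
  then show ?thesis using A(1) by blast
qed

text \<open>The separating sets are the balls of radius \<open>1 / (k + 1)\<close> about the points of a countable dense
  set.\<close>

lemma standard_borel_separating_sequence:
  assumes "standard_borel M"
  shows "\<exists>E :: nat \<Rightarrow> 'a set. (\<forall>i. E i \<in> sets (M :: 'a measure)) \<and>
           (\<forall>x\<in>space M. \<forall>y\<in>space M. x \<noteq> y \<longrightarrow> (\<exists>i. x \<in> E i \<longleftrightarrow> y \<notin> E i))"
proof -
  obtain T where T: "completely_metrizable_space T" "separable_space T" "topspace T = space M"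
      "sets M = sigma_sets (topspace T) {U. openin T U}"
    using assms unfolding standard_borel_def by blast
  obtain X m where "Metric_space X m" and Tm: "T = Metric_space.mtopology X m"
    using completely_metrizable_imp_metrizable_space[OF T(1)] unfolding metrizable_space_def by blast
  then interpret Metric_space X m by simp
  obtain D where D: "countable D" "D \<subseteq> X" "mtopology closure_of D = X"
    using T(2) unfolding separable_space_def Tm by auto
  have XM: "space M = X" using T(3) Tm by simp
  \<comment> \<open>The empty set is added so that there is a sequence to list even when the space is empty.\<close>
  define F where "F = insert {} ((\<lambda>(p, k). mball p (1 / real (Suc k))) ` (D \<times> UNIV))"
  have "countable F" "F \<noteq> {}" using D(1) by (auto simp: F_def)
  then have ran: "range (from_nat_into F) = F" by (rule range_from_nat_into[rotated])
  have "openin T U" if "U \<in> F" for U using that unfolding F_def Tm by (auto simp: openin_mball)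
  then have "from_nat_into F i \<in> sets M" for i
    unfolding T(4) using ran by (intro sigma_sets.Basic) (metis mem_Collect_eq rangeI)
  moreover have "\<exists>i. x \<in> from_nat_into F i \<longleftrightarrow> y \<notin> from_nat_into F i"
    if xy: "x \<in> X" "y \<in> X" "x \<noteq> y" for x y
  proof -
    have "m x y / 2 > 0" using xy by simp
    then obtain k where k: "1 / real (Suc k) < m x y / 2"
      using nat_approx_posE by blast
    have "D \<inter> mball x (1 / real (Suc k)) \<noteq> {}"
      using D(3) xy dense_intersects_open[of mtopology D] by (metis centre_in_mball_iff empty_iff of_nat_0_less_iff openin_mball topspace_mtopology zero_less_Suc zero_less_divide_1_iff)
    then obtain p where p: "p \<in> D" "p \<in> X" "m x p < 1 / real (Suc k)" by (auto simp: in_mball)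
    let ?U = "mball p (1 / real (Suc k))"
    have "x \<in> ?U" using p xy by (simp add: in_mball commute)
    moreover have "y \<notin> ?U"
      using triangle[of x p y] k p xy by (auto simp: in_mball)
    moreover have "?U \<in> F" using p by (auto simp: F_def)
    ultimately show ?thesis by (metis ran imageE)
  qed
  ultimately show ?thesis unfolding XM by blast
qed

section \<open>Comeager sets of classes\<close>

text \<open>A Baire category criterion for functions instead of classes. The openness hypothesis \<open>perturb\<close> also
  makes each \<open>P n\<close> invariant under almost everywhere equality, because equivalent functions differ on
  a set of measure \<open>0\<close>; so \<open>P n\<close> is a condition on classes.\<close>

lemma comeager_in_L0I:
  fixes P :: "nat \<Rightarrow> ('a \<Rightarrow> complex) \<Rightarrow> bool"
  assumes "finite_measure M"
    and perturb: "\<And>n f. f \<in> M \<rightarrow>\<^sub>M circle \<Longrightarrow> P n f \<Longrightarrow> \<exists>e>0. \<forall>g\<in>M \<rightarrow>\<^sub>M circle.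
           measure M {x \<in> space M. e \<le> dist (f x) (g x)} < e \<longrightarrow> P n g"
    and dense: "\<And>n f e. f \<in> M \<rightarrow>\<^sub>M circle \<Longrightarrow> e > 0 \<Longrightarrow>
           \<exists>g\<in>M \<rightarrow>\<^sub>M circle. (\<forall>x\<in>space M. dist (f x) (g x) < e) \<and> P n g"
    and concl: "\<And>f. f \<in> M \<rightarrow>\<^sub>M circle \<Longrightarrow> (\<And>n. P n f) \<Longrightarrow> Q f"
  shows "comeager_in (L0_topology M) {F \<in> L0 M. \<forall>f\<in>F. Q f}"
proof -
  interpret finite_measure M by fact
  have rep: "f \<in> M \<rightarrow>\<^sub>M circle" if "F \<in> L0 M" "f \<in> F" for F f
    using that equiv_ae_eq_rel[of M] unfolding L0_def by (meson in_quotient_imp_subset subsetD)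
  have eqv: "AE x in M. f x = g x" if "F \<in> L0 M" "f \<in> F" "g \<in> F" for F f g
    using in_quotient_imp_in_rel[OF equiv_ae_eq_rel, of F M f g] that
    unfolding L0_def by (auto simp: ae_eq_rel_def)
  have P_ae: "P n g" if F: "F \<in> L0 M" "f \<in> F" "g \<in> F" and "P n f" for n F f g
  proof -
    obtain e where e: "e > 0"
      "\<And>g. g \<in> M \<rightarrow>\<^sub>M circle \<Longrightarrow> measure M {x \<in> space M. e \<le> dist (f x) (g x)} < e \<Longrightarrow> P n g"
      using perturb[OF rep[OF F(1,2)] \<open>P n f\<close>] by blast
    have "measure M {x \<in> space M. e \<le> dist (f x) (g x)} \<le> measure M {}"
      using eqv[OF F] \<open>e > 0\<close> by (intro finite_measure_mono_AE) (auto elim!: eventually_mono)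
    then show ?thesis using e rep[OF F(1,3)] by simp
  qed
  define U where "U n = {F \<in> L0 M. \<forall>f\<in>F. P n f}" for n
  have "openin (L0_topology M) (U n)" for n
    unfolding openin_L0_topology L0_open_def
  proof (intro conjI ballI)
    show "U n \<subseteq> L0 M" by (auto simp: U_def)
    fix F assume F: "F \<in> U n"
    then have FL: "F \<in> L0 M" by (simp add: U_def)
    then obtain f where f: "f \<in> F"
      using equiv_ae_eq_rel[of M] unfolding L0_def by (metis ex_in_conv in_quotient_imp_non_empty)
    then obtain e where e: "e > 0"
      "\<And>g. g \<in> M \<rightarrow>\<^sub>M circle \<Longrightarrow> measure M {x \<in> space M. e \<le> dist (f x) (g x)} < e \<Longrightarrow> P n g"
      using perturb[OF rep[OF FL f]] F unfolding U_def by blast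
    have "G \<in> U n" if G: "G \<in> L0 M" "f' \<in> F" "g \<in> G"
        "emeasure M {x \<in> space M. e \<le> dist (f' x) (g x)} < ennreal e" for G f' g
    proof -
      have fm: "f \<in> M \<rightarrow>\<^sub>M circle" "f' \<in> M \<rightarrow>\<^sub>M circle" "g \<in> M \<rightarrow>\<^sub>M circle"
        using rep FL f G by auto
      have "measure M {x \<in> space M. e \<le> dist (f x) (g x)} = measure M {x \<in> space M. e \<le> dist (f' x) (g x)}"
        using eqv[OF FL f G(2)] fm
        by (intro measure_eq_AE dist_ge_sets) (auto elim!: eventually_mono)
      also have "\<dots> < e" using G(4) \<open>e > 0\<close> by (simp add: emeasure_eq_measure ennreal_less_iff)
      finally have "P n g" using e(2) fm(3) by blast
      then show ?thesis using P_ae[OF G(1,3)] G(1) by (auto simp: U_def)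
    qed
    then show "\<exists>e>0. \<forall>G\<in>L0 M. \<forall>f\<in>F. \<forall>g\<in>G.
        emeasure M {x \<in> space M. e \<le> dist (f x) (g x)} < ennreal e \<longrightarrow> G \<in> U n"
      using \<open>e > 0\<close> by blast
  qed
  moreover have "L0_topology M closure_of U n = topspace (L0_topology M)" for n
    unfolding dense_intersects_open
  proof (intro allI impI, elim conjE)
    fix V assume V: "openin (L0_topology M) V" "V \<noteq> {}"
    then obtain F where F: "F \<in> V" by blast
    have FL: "F \<in> L0 M" using V(1) F unfolding openin_L0_topology L0_open_def by blast
    then obtain f where f: "f \<in> F"
      using equiv_ae_eq_rel[of M] unfolding L0_def by (metis ex_in_conv in_quotient_imp_non_empty)
    obtain e where e: "e > 0" "\<And>G f g. \<lbrakk>G \<in> L0 M; f \<in> F; g \<in> G;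
        emeasure M {x \<in> space M. e \<le> dist (f x) (g x)} < ennreal e\<rbrakk> \<Longrightarrow> G \<in> V"
      using V(1) F unfolding openin_L0_topology L0_open_def by meson
    obtain g where g: "g \<in> M \<rightarrow>\<^sub>M circle" "\<And>x. x \<in> space M \<Longrightarrow> dist (f x) (g x) < e" "P n g"
      using dense[OF rep[OF FL f] \<open>e > 0\<close>] by blast
    let ?G = "ae_eq_rel M `` {g}"
    have G: "?G \<in> L0 M" unfolding L0_def using g(1) by (rule quotientI)
    have gG: "g \<in> ?G" using g(1) by (rule equiv_class_self[OF equiv_ae_eq_rel])
    have "{x \<in> space M. e \<le> dist (f x) (g x)} = {}" using g(2) by fastforce
    then have "emeasure M {x \<in> space M. e \<le> dist (f x) (g x)} < ennreal e"
      using e(1) by (simp only: emeasure_empty ennreal_less_zero_iff)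
    then have "?G \<in> V" by (rule e(2)[OF G f gG])
    moreover have "?G \<in> U n" using P_ae[OF G gG _ g(3)] G by (auto simp: U_def)
    ultimately show "U n \<inter> V \<noteq> {}" by blast
  qed
  moreover have "F \<in> {F \<in> L0 M. \<forall>f\<in>F. Q f}" if "F \<in> L0 M \<inter> \<Inter> (range U)" for F
    using that concl rep by (auto simp: U_def)
  ultimately show ?thesis
    unfolding comeager_in_def by (intro conjI exI[of _ "range U"]) auto
qed

section \<open>From independence to almost disjointness\<close>

text \<open>Products over tuples are rewritten as products over sets of points, so that the two sides of an
  equality can be combined; the exponent \<open>0\<close> off the tuple makes the product independent of the choice of
  the surrounding set.\<close>

definition exponent_at :: "int list \<Rightarrow> 'a list \<Rightarrow> 'a \<Rightarrow> int" where
  "exponent_at \<kappa> xs z = (case map_of (zip xs \<kappa>) z of Some k \<Rightarrow> k | None \<Rightarrow> 0)"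

lemma tuple_power_eq_prod:
  assumes "length xs = length \<kappa>" "distinct xs" "finite J" "set xs \<subseteq> J"
  shows "tuple_power f \<kappa> xs = (\<Prod>z\<in>J. f z powi exponent_at \<kappa> xs z)"
proof -
  have "(\<Prod>z\<in>J. f z powi exponent_at \<kappa> xs z) = (\<Prod>z\<in>set xs. f z powi exponent_at \<kappa> xs z)"
  proof (rule prod.mono_neutral_right)
    show "\<forall>z\<in>J - set xs. f z powi exponent_at \<kappa> xs z = 1"
    proof
      fix z assume "z \<in> J - set xs"
      then have "map_of (zip xs \<kappa>) z = None"
        using assms(1) by (simp add: map_of_zip_is_None)
      then show "f z powi exponent_at \<kappa> xs z = 1" by (simp add: exponent_at_def)
    qed
  qed (use assms in auto)
  also have "set xs = (!) xs ` {..<length \<kappa>}"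
    using assms(1) by (auto simp: set_conv_nth)
  also have "(\<Prod>z\<in>(!) xs ` {..<length \<kappa>}. f z powi exponent_at \<kappa> xs z)
      = (\<Prod>i<length \<kappa>. f (xs ! i) powi exponent_at \<kappa> xs (xs ! i))"
    using assms(1,2) by (subst prod.reindex) (auto simp: inj_on_nth)
  also have "\<dots> = (\<Prod>i<length \<kappa>. f (xs ! i) powi (\<kappa> ! i))"
    using assms(1,2) by (intro prod.cong) (auto simp: exponent_at_def map_of_zip_nth)
  finally show ?thesis by (simp add: tuple_power_def)
qed

lemma set_zip_eq_exponent_at:
  assumes "length xs = length \<kappa>" "distinct xs" "0 \<notin> set \<kappa>"
  shows "set (zip xs \<kappa>) = {(z, k). k \<noteq> 0 \<and> exponent_at \<kappa> xs z = k}"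
proof -
  have "map fst (zip xs \<kappa>) = xs" using assms(1) by simp
  then have iff: "map_of (zip xs \<kappa>) z = Some k \<longleftrightarrow> (z, k) \<in> set (zip xs \<kappa>)" for z k
    using assms(2) by (simp add: map_of_eq_Some_iff)
  moreover have "k \<noteq> 0" if "(z, k) \<in> set (zip xs \<kappa>)" for z k
    using that assms(3) set_zip_rightD by fastforce
  ultimately have "(z, k) \<in> set (zip xs \<kappa>) \<longleftrightarrow> k \<noteq> 0 \<and> exponent_at \<kappa> xs z = k" for z k
    unfolding exponent_at_def iff[symmetric] by (cases "map_of (zip xs \<kappa>) z") auto
  then show ?thesis by auto
qed

text \<open>Independence forces the exponent functions of both sides to agree. By \<open>set_zip_eq_exponent_at\<close>
  the exponent function determines the set of pairs of a point and its exponent, as no exponent is \<open>0\<close>.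
  A single permutation then carries the list of pairs \<open>zip xs \<kappa>\<close> to \<open>zip ys \<kappa>'\<close>, and hence \<open>xs\<close> to \<open>ys\<close>
  and \<open>\<kappa>\<close> to \<open>\<kappa>'\<close>.\<close>

lemma almost_disjoint_if_mult_independent:
  assumes A: "A \<in> null_sets M" and ind: "mult_independent_on f (space M - A)"
    and norm: "\<And>x. x \<in> space M \<Longrightarrow> norm (f x) = 1"
    and nz: "0 \<notin> set \<kappa>" "0 \<notin> set \<kappa>'"
  shows "almost_disjoint M {r. r permutes {..<length \<kappa>} \<and> \<kappa>' = permute_list r \<kappa>} f \<kappa> \<kappa>'"
  unfolding almost_disjoint_def
proof (intro bexI[OF _ A] allI impI, elim conjE)
  fix xs ys
  assume xs: "length xs = length \<kappa>" "distinct xs" "set xs \<subseteq> space M - A"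
    and ys: "length ys = length \<kappa>'" "distinct ys" "set ys \<subseteq> space M - A"
    and eq: "tuple_power f \<kappa> xs = tuple_power f \<kappa>' ys"
  let ?J = "set xs \<union> set ys"
  let ?a = "exponent_at \<kappa> xs" and ?b = "exponent_at \<kappa>' ys"
  have nonzero: "f z \<noteq> 0" if "z \<in> ?J" for z
    using norm[of z] that xs(3) ys(3) by fastforce
  have "(\<Prod>z\<in>?J. f z powi (?a z - ?b z)) = (\<Prod>z\<in>?J. f z powi ?a z) / (\<Prod>z\<in>?J. f z powi ?b z)"
    unfolding prod_dividef[symmetric] using nonzero by (intro prod.cong) (auto simp: power_int_diff)
  also have "\<dots> = tuple_power f \<kappa> xs / tuple_power f \<kappa>' ys"
    using xs ys by (simp add: tuple_power_eq_prod[of _ _ ?J])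
  also have "\<dots> = 1"
    using eq ys nonzero by (simp add: tuple_power_eq_prod[of _ _ ?J])
  finally have "\<forall>z\<in>?J. ?a z - ?b z = 0"
    using xs(3) ys(3) ind[unfolded mult_independent_on_def, rule_format, of ?J "\<lambda>z. ?a z - ?b z"]
    by auto
  moreover have "?a z = ?b z" if "z \<notin> ?J" for z
  proof -
    have "map_of (zip xs \<kappa>) z = None" "map_of (zip ys \<kappa>') z = None"
      using that xs(1) ys(1) by (simp_all add: map_of_zip_is_None)
    then show ?thesis by (simp add: exponent_at_def)
  qed
  ultimately have "?a = ?b" by (intro ext) (metis eq_iff_diff_eq_0)
  then have "set (zip ys \<kappa>') = set (zip xs \<kappa>)"
    using xs ys nz by (simp add: set_zip_eq_exponent_at)
  then have "mset (zip ys \<kappa>') = mset (zip xs \<kappa>)"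
    using xs(2) ys(2) by (subst set_eq_iff_mset_eq_distinct[symmetric]) (simp_all add: distinct_zipI1)
  then obtain r where r: "r permutes {..<length (zip xs \<kappa>)}" "permute_list r (zip xs \<kappa>) = zip ys \<kappa>'"
    by (rule mset_eq_permutation)
  have r': "r permutes {..<length \<kappa>}" using r(1) xs(1) by simp
  have z: "zip ys \<kappa>' = zip (permute_list r xs) (permute_list r \<kappa>)"
    using r(2) permute_list_zip[of r "{..<length xs}" xs \<kappa>] r' xs(1) by simp
  have len: "length (permute_list r xs) = length (permute_list r \<kappa>)" using xs(1) by simp
  have "ys = permute_list r xs"
    using arg_cong[OF z, of "map fst"] by (simp only: map_fst_zip[OF ys(1)] map_fst_zip[OF len])
  moreover have "\<kappa>' = permute_list r \<kappa>"
    using arg_cong[OF z, of "map snd"] by (simp only: map_snd_zip[OF ys(1)] map_snd_zip[OF len])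
  ultimately show "\<exists>r\<in>{r. r permutes {..<length \<kappa>} \<and> \<kappa>' = permute_list r \<kappa>}. ys = permute_list r xs"
    using r' by blast
qed

theorem theorem3p8:
  fixes M :: "'a measure" and \<kappa> \<kappa>' :: "int list"
  assumes "prob_space M" and "standard_borel M" and "nonatomic M"
    and "0 \<notin> set \<kappa>" and "0 \<notin> set \<kappa>'"
    and "R = {r. r permutes {..<length \<kappa>} \<and> \<kappa>' = permute_list r \<kappa>}"
  shows "comeager_in (L0_topology M)
           {F \<in> L0 M. \<forall>f\<in>F. almost_disjoint M R f \<kappa> \<kappa>'}"
proof -
  interpret prob_space M by fact
  have fin: "finite_measure M" by unfold_locales
  obtain E :: "nat \<Rightarrow> 'a set" where E: "\<And>i. E i \<in> sets M"
      "\<And>x y. x \<in> space M \<Longrightarrow> y \<in> space M \<Longrightarrow> x \<noteq> y \<Longrightarrow> \<exists>i. x \<in> E i \<longleftrightarrow> y \<notin> E i"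
    using standard_borel_separating_sequence[OF assms(2)] by metis
  show ?thesis
  proof (rule comeager_in_L0I[OF fin, where P = "near_independent M E"])
    fix f assume f: "f \<in> M \<rightarrow>\<^sub>M circle" "\<And>n. near_independent M E n f"
    then obtain A where "A \<in> null_sets M" "mult_independent_on f (space M - A)"
      using mult_independent_if_near_independent[OF fin E(2)] by blast
    then show "almost_disjoint M R f \<kappa> \<kappa>'"
      unfolding assms(6) using f(1) assms(4,5)
      by (intro almost_disjoint_if_mult_independent) (auto simp: circle_measurable_iff)
  qed (auto intro: near_independent_perturb[OF fin] near_independent_dense E)
qed

end
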